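(* Let $\mathfrak{g}$ be a finite dimensional nilpotent Lie algebra over $\mathbb{R}$ or $\mathbb{C}$, and let $\mathfrak{k}\subsetneqq\mathfrak{h}\subsetneqq\mathfrak{g}$ be proper subalgebras such that $\mathfrak{k}$ is an ideal of $\mathfrak{h}$, $\mathfrak{h}$ is an ideal of $\mathfrak{g}$, but $\mathfrak{k}$ is not an ideal of $\mathfrak{g}$. If the pair $(\mathfrak{g},\mathfrak{k})$ is effective, then $o(\mathfrak{g},\mathfrak{k})\geq s(\mathfrak{k})$.
   Context: All Lie algebras are finite dimensional over $\mathbb{R}$ or $\mathbb{C}$. A pair $(\mathfrak{g},\mathfrak{k})$ consisting of a Lie algebra $\mathfrak{g}$ and a subalgebra $\mathfrak{k}\subset\mathfrak{g}$ is called effective if $\mathfrak{k}$ contains no nonzero ideal of $\mathfrak{g}$. Set $\mathfrak{k}_0=\mathfrak{k}$ and define inductively for $i\geq 0$ $$\mathfrak{k}_{i+1}=\{x\in\mathfrak{k}_i\mid [x,\mathfrak{g}]\subset\mathfrak{k}_i\}.$$ This descending chain reaches $\{0\}$ when the pair is effective, and the order $o(\mathfrak{g},\mathfrak{k})$ is the smallest integer $r\geq 0$ with $\mathfrak{k}_r=\{0\}$. For a solvable Lie algebra $\mathfrak{k}$, the derived series is $\mathfrak{k}^{(0)}=\mathfrak{k}$, $\mathfrak{k}^{(i+1)}=[\mathfrak{k}^{(i)},\mathfrak{k}^{(i)}]$, and the sol-length (derived length) $s(\mathfrak{k})$ is the smallest integer $s\geq 0$ with $\mathfrak{k}^{(s)}=0$.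 (Subalgebras of nilpotent Lie algebras are nilpotent, hence solvable, so $s(\mathfrak{k})$ is defined.) *)

theory Defs
  imports Complex_Main
begin

text \<open>The scalar field is \<open>\<real>\<close> or \<open>\<complex>\<close>. A bijection compatible with addition and
  multiplication automatically preserves 0 and 1.\<close>

class real_or_complex = field +
  assumes real_or_complex:
    "(\<exists>f :: 'a \<Rightarrow> real. bij f \<and> (\<forall>x y. f (x + y) = f x + f y) \<and> (\<forall>x y. f (x * y) = f x * f y)) \<or>
     (\<exists>f :: 'a \<Rightarrow> complex. bij f \<and> (\<forall>x y. f (x + y) = f x + f y) \<and> (\<forall>x y. f (x * y) = f x * f y))"

instance real :: real_or_complex
  by standard (rule disjI1, rule exI[of _ id], simp)

instance complex :: real_or_complex
  by standard (rule disjI2, rule exI[of _ id], simp)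

text \<open>The Lie algebra is the whole type \<open>'b\<close>; subalgebras and ideals are sets.\<close>

locale lie_algebra = vector_space scale
  for scale :: "'k :: field \<Rightarrow> 'b :: ab_group_add \<Rightarrow> 'b" +
  fixes bracket :: "'b \<Rightarrow> 'b \<Rightarrow> 'b"
  assumes linear_bracket_left: "\<And>y. Vector_Spaces.linear scale scale (\<lambda>x. bracket x y)"
    and linear_bracket_right: "\<And>x. Vector_Spaces.linear scale scale (\<lambda>y. bracket x y)"
    and bracket_self: "\<And>x. bracket x x = 0"
    and jacobi: "\<And>x y z. bracket x (bracket y z) + bracket y (bracket z x) + bracket z (bracket x y) = 0"
begin

definition subalgebra :: "'b set \<Rightarrow> bool" where
  "subalgebra h \<longleftrightarrow> subspace h \<and> (\<forall>x\<in>h. \<forall>y\<in>h. bracket x y \<in> h)"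

definition ideal_of :: "'b set \<Rightarrow> 'b set \<Rightarrow> bool" where
  "ideal_of a g \<longleftrightarrow> subspace a \<and> a \<subseteq> g \<and> (\<forall>x\<in>g. \<forall>y\<in>a. bracket x y \<in> a)"

definition commutator :: "'b set \<Rightarrow> 'b set \<Rightarrow> 'b set" where
  "commutator a b = span {bracket x y | x y. x \<in> a \<and> y \<in> b}"

primrec lower_central_series :: "'b set \<Rightarrow> nat \<Rightarrow> 'b set" where
  "lower_central_series g 0 = g"
| "lower_central_series g (Suc i) = commutator g (lower_central_series g i)"

definition nilpotent :: "'b set \<Rightarrow> bool" where
  "nilpotent g \<longleftrightarrow> (\<exists>n. lower_central_series g n = {0})"

primrec derived_series :: "'b set \<Rightarrow> nat \<Rightarrow> 'b set" where
  "derived_series k 0 = k"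
| "derived_series k (Suc i) = commutator (derived_series k i) (derived_series k i)"

text \<open>Only meaningful for solvable \<open>k\<close>: otherwise no such index exists.\<close>

definition sol_length :: "'b set \<Rightarrow> nat" where
  "sol_length k = (LEAST s. derived_series k s = {0})"

definition effective :: "'b set \<Rightarrow> 'b set \<Rightarrow> bool" where
  "effective g k \<longleftrightarrow> (\<forall>a. ideal_of a g \<and> a \<subseteq> k \<longrightarrow> a = {0})"

primrec isotropy_chain :: "'b set \<Rightarrow> 'b set \<Rightarrow> nat \<Rightarrow> 'b set" where
  "isotropy_chain g k 0 = k"
| "isotropy_chain g k (Suc i) =
     {x \<in> isotropy_chain g k i. \<forall>y\<in>g. bracket x y \<in> isotropy_chain g k i}"

text \<open>Only meaningful when the chain reaches \<open>{0}\<close>, as it does for effective pairs in finite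
  dimension.\<close>

definition pair_order :: "'b set \<Rightarrow> 'b set \<Rightarrow> nat" where
  "pair_order g k = (LEAST r. isotropy_chain g k r = {0})"

end

locale finite_dimensional_lie_algebra = lie_algebra +
  assumes finite_dimensional: "\<exists>B. finite B \<and> span B = UNIV"

end

theory Submission
  imports Defs
begin

text \<open>Write \<open>k\<^sub>i\<close> for the isotropy chain of \<open>(\<gg>, \<kk>)\<close>. The Jacobi identity, together with
  \<open>[\<hh>, \<gg>] \<subseteq> \<hh>\<close>, shows by induction that not only \<open>\<kk>\<close> but every \<open>k\<^sub>i\<close> is an ideal of \<open>\<hh>\<close>
  (\<open>isotropy_chain_ideal_of\<close>). Therefore, if \<open>x, y \<in> k\<^sub>i\<close> and \<open>z \<in> \<gg>\<close>, both terms of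
  \<open>[z, [x, y]] = [[z, x], y] + [x, [z, y]]\<close> are brackets of an element of \<open>\<hh>\<close> with an element
  of \<open>k\<^sub>i\<close>, and so they stay in \<open>k\<^sub>i\<close>. This says \<open>[k\<^sub>i, k\<^sub>i] \<subseteq> k\<^sub>i\<^sub>+\<^sub>1\<close>: the derived
  series of \<open>\<kk>\<close> descends at least as fast as the isotropy chain
  (\<open>derived_series_subset_isotropy_chain\<close>).

  If the isotropy chain is zero at an index \<open>r\<close>, then so is the derived series. Such an \<open>r\<close>
  exists because in finite dimension the chain becomes stationary, and a stationary term is an
  ideal of \<open>\<gg>\<close> inside \<open>\<kk>\<close>, which effectiveness forces to be zero
  (\<open>isotropy_chain_reaches_zero\<close>).\<close>

context lie_algebra
begin

lemma bracket_add_left: "bracket (x + y) z = bracket x z + bracket y z"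
  using linear_bracket_left by (rule Vector_Spaces.linear.axioms(3)[THEN module_hom.add])

lemma bracket_add_right: "bracket x (y + z) = bracket x y + bracket x z"
  using linear_bracket_right by (rule Vector_Spaces.linear.axioms(3)[THEN module_hom.add])

lemma bracket_scale_left: "bracket (scale c x) z = scale c (bracket x z)"
  using linear_bracket_left by (rule Vector_Spaces.linear.axioms(3)[THEN module_hom.scale])

lemma bracket_zero_left: "bracket 0 z = 0"
  using bracket_scale_left[of 0 0 z] by simp

lemma bracket_minus_right: "bracket x (- y) = - bracket x y"
proof -
  have "bracket x (y + - y) = 0"
    using bracket_add_right[of x 0 0] by simp
  then show ?thesis
    unfolding bracket_add_right by (rule minus_unique[symmetric])
qed

lemma bracket_anti: "bracket x y = - bracket y x"
proof -
  have "bracket (x + y) (x + y) = bracket x y + bracket y x"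
    unfolding bracket_add_left bracket_add_right by (simp add: bracket_self)
  then show ?thesis
    by (simp add: bracket_self eq_neg_iff_add_eq_0)
qed

lemma bracket_leibniz: "bracket z (bracket x y) = bracket (bracket z x) y + bracket x (bracket z y)"
proof -
  have "bracket x (bracket y z) = - bracket x (bracket z y)"
    using bracket_anti[of y z] by (simp add: bracket_minus_right)
  moreover have "bracket y (bracket z x) = - bracket (bracket z x) y"
    by (rule bracket_anti)
  ultimately show ?thesis
    using jacobi[of x y z] by (simp add: algebra_simps)
qed

lemma ideal_of_subspace: "ideal_of a g \<Longrightarrow> subspace a"
  unfolding ideal_of_def by blast

lemma ideal_of_subset: "ideal_of a g \<Longrightarrow> a \<subseteq> g"
  unfolding ideal_of_def by blast

lemma ideal_of_bracket: "ideal_of a g \<Longrightarrow> x \<in> g \<Longrightarrow> y \<in> a \<Longrightarrow> bracket x y \<in> a"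
  unfolding ideal_of_def by blast

lemma ideal_of_bracket': "ideal_of a g \<Longrightarrow> x \<in> a \<Longrightarrow> y \<in> g \<Longrightarrow> bracket x y \<in> a"
  using ideal_of_bracket[of a g y x] ideal_of_subspace[of a g] subspace_neg
  by (subst bracket_anti) blast

lemma subspace_isotropy_chain: "subspace k \<Longrightarrow> subspace (isotropy_chain g k i)"
proof (induction i)
  case (Suc i)
  then have "subspace (isotropy_chain g k i)" by simp
  then show ?case
    by (auto simp: subspace_def bracket_add_left bracket_scale_left bracket_zero_left)
qed simp

lemma isotropy_chain_subset: "isotropy_chain g k i \<subseteq> k"
  by (induction i) auto

text \<open>In the step, \<open>[[w, x], z] = [w, [x, z]] - [x, [w, z]]\<close>. The first term is controlled by
  the induction hypothesis, since \<open>[x, z] \<in> k\<^sub>i\<close>, and the second by \<open>x \<in> k\<^sub>i\<^sub>+\<^sub>1\<close>, since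
  \<open>[w, z] \<in> h \<subseteq> g\<close>.\<close>

lemma isotropy_chain_ideal_of:
  assumes h: "ideal_of h g" and k: "ideal_of k h"
  shows "ideal_of (isotropy_chain g k i) h"
proof (induction i)
  case 0
  show ?case using k by simp
next
  case (Suc i)
  let ?K = "isotropy_chain g k i"
  have "bracket w x \<in> isotropy_chain g k (Suc i)"
    if w: "w \<in> h" and x: "x \<in> isotropy_chain g k (Suc i)" for w x
  proof -
    have "bracket (bracket w x) z \<in> ?K" if z: "z \<in> g" for z
    proof -
      have "bracket w (bracket x z) \<in> ?K"
        using Suc w x z ideal_of_bracket by auto
      moreover have "bracket x (bracket w z) \<in> ?K"
        using x ideal_of_bracket'[OF h w z] ideal_of_subset[OF h] by auto
      ultimately have "bracket w (bracket x z) - bracket x (bracket w z) \<in> ?K"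
        using subspace_diff[OF ideal_of_subspace[OF Suc]] by blast
      then show ?thesis
        by (simp add: bracket_leibniz[of w x z])
    qed
    moreover have "bracket w x \<in> ?K"
      using Suc w x ideal_of_bracket by auto
    ultimately show ?thesis by simp
  qed
  moreover have "subspace (isotropy_chain g k (Suc i))"
    using k by (intro subspace_isotropy_chain ideal_of_subspace)
  moreover have "isotropy_chain g k (Suc i) \<subseteq> h"
    using isotropy_chain_subset ideal_of_subset[OF k] by blast
  ultimately show ?case
    unfolding ideal_of_def by blast
qed

text \<open>For \<open>x, y \<in> k\<^sub>i\<close> the inner brackets \<open>[x, z]\<close> and \<open>[y, z]\<close> may leave \<open>k\<^sub>i\<close>, but they stay in
  \<open>h\<close>, and bracketing with \<open>h\<close> preserves \<open>k\<^sub>i\<close>.\<close>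

lemma commutator_isotropy_chain_subset:
  assumes h: "ideal_of h g" and k: "ideal_of k h"
  shows "commutator (isotropy_chain g k i) (isotropy_chain g k i) \<subseteq> isotropy_chain g k (Suc i)"
proof -
  let ?K = "isotropy_chain g k i"
  have K: "ideal_of ?K h"
    by (rule isotropy_chain_ideal_of[OF h k])
  have "bracket x y \<in> isotropy_chain g k (Suc i)" if x: "x \<in> ?K" and y: "y \<in> ?K" for x y
  proof -
    have xh: "x \<in> h" and yh: "y \<in> h"
      using x y ideal_of_subset[OF K] by blast+
    have "bracket (bracket x y) z \<in> ?K" if z: "z \<in> g" for z
    proof -
      have "bracket x (bracket y z) \<in> ?K" "bracket y (bracket x z) \<in> ?K"
        using ideal_of_bracket'[OF K] ideal_of_bracket'[OF h] x y xh yh z by blast+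
      then have "bracket x (bracket y z) - bracket y (bracket x z) \<in> ?K"
        using subspace_diff[OF ideal_of_subspace[OF K]] by blast
      then show ?thesis
        by (simp add: bracket_leibniz[of x y z])
    qed
    moreover have "bracket x y \<in> ?K"
      by (rule ideal_of_bracket[OF K xh y])
    ultimately show ?thesis by simp
  qed
  moreover have "subspace (isotropy_chain g k (Suc i))"
    using k by (intro subspace_isotropy_chain ideal_of_subspace)
  ultimately show ?thesis
    unfolding commutator_def by (intro span_minimal) blast+
qed

lemma commutator_mono: "a \<subseteq> a' \<Longrightarrow> b \<subseteq> b' \<Longrightarrow> commutator a b \<subseteq> commutator a' b'"
  unfolding commutator_def by (rule span_mono) blast

lemma derived_series_subset_isotropy_chain:
  assumes "ideal_of h g" and "ideal_of k h"
  shows "derived_series k i \<subseteq> isotropy_chain g k i"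
proof (induction i)
  case (Suc i)
  then show ?case
    using commutator_mono[OF Suc Suc] commutator_isotropy_chain_subset[OF assms, of i] by simp
qed simp

lemma subspace_derived_series: "subspace k \<Longrightarrow> subspace (derived_series k i)"
  by (cases i) (simp_all add: commutator_def)

lemma stationary_isotropy_chain_ideal_of:
  assumes "subspace k" and "k \<subseteq> g" and eq: "isotropy_chain g k (Suc i) = isotropy_chain g k i"
  shows "ideal_of (isotropy_chain g k i) g"
proof -
  have sub: "subspace (isotropy_chain g k i)"
    by (rule subspace_isotropy_chain[OF assms(1)])
  have "bracket y x \<in> isotropy_chain g k i" if "y \<in> g" "x \<in> isotropy_chain g k i" for x y
  proof -
    have "x \<in> isotropy_chain g k (Suc i)" using that eq by blast
    then have "- bracket x y \<in> isotropy_chain g k i"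
      using that subspace_neg[OF sub] by simp
    then show ?thesis by (subst bracket_anti)
  qed
  moreover have "isotropy_chain g k i \<subseteq> g"
    using isotropy_chain_subset assms(2) by blast
  ultimately show ?thesis
    using sub unfolding ideal_of_def by blast
qed

end

context finite_dimensional_lie_algebra
begin

text \<open>This makes the least index in the definition of \<open>pair_order\<close> an actual one.\<close>

lemma isotropy_chain_reaches_zero:
  assumes k: "subspace k" "k \<subseteq> g" and eff: "effective g k"
  shows "\<exists>r. isotropy_chain g k r = {0}"
proof -
  obtain S where S: "finite S" "span S = UNIV"
    using finite_dimensional by blast
  obtain B where "B \<subseteq> S" "independent B" "S \<subseteq> span B"
    using maximal_independent_subset by blast
  then interpret fd: finite_dimensional_vector_space scale B
    using S finite_subset span_minimal[OF \<open>S \<subseteq> span B\<close> subspace_span] by unfold_locales auto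
  \<comment> \<open>The chain cannot drop strictly at a term of least dimension.\<close>
  obtain r where r: "\<And>i. dim (isotropy_chain g k r) \<le> dim (isotropy_chain g k i)"
    using ex_has_least_nat[of "\<lambda>_. True" _ "\<lambda>i. dim (isotropy_chain g k i)"] by blast
  have "isotropy_chain g k (Suc r) = isotropy_chain g k r"
    by (rule fd.subspace_dim_equal)
      (use r subspace_isotropy_chain[OF k(1)] in \<open>auto simp del: isotropy_chain.simps(2)\<close>,
        simp)
  then have "ideal_of (isotropy_chain g k r) g"
    by (rule stationary_isotropy_chain_ideal_of[OF k])
  then show ?thesis
    using eff isotropy_chain_subset unfolding effective_def by blast
qed

lemma sol_length_le_pair_order:
  assumes h: "ideal_of h g" and k: "ideal_of k h" and eff: "effective g k"
  shows "sol_length k \<le> pair_order g k"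
proof -
  have sub: "subspace k"
    by (rule ideal_of_subspace[OF k])
  have "k \<subseteq> g"
    using ideal_of_subset[OF h] ideal_of_subset[OF k] by blast
  then have "isotropy_chain g k (pair_order g k) = {0}"
    unfolding pair_order_def by (rule LeastI_ex[OF isotropy_chain_reaches_zero[OF sub _ eff]])
  then have "derived_series k (pair_order g k) = {0}"
    using derived_series_subset_isotropy_chain[OF h k, of "pair_order g k"]
      subspace_0[OF subspace_derived_series[OF sub, of "pair_order g k"]] by blast
  then show ?thesis
    unfolding sol_length_def by (rule Least_le)
qed

end

theorem proposition9:
  fixes scale :: "'k :: real_or_complex \<Rightarrow> 'b :: ab_group_add \<Rightarrow> 'b"
    and bracket :: "'b \<Rightarrow> 'b \<Rightarrow> 'b"
    and \<gg> \<hh> \<kk> :: "'b set"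
  assumes "finite_dimensional_lie_algebra scale bracket"
    and "\<gg> = UNIV"
    and "lie_algebra.nilpotent scale bracket \<gg>"
    and "lie_algebra.subalgebra scale bracket \<kk>"
    and "lie_algebra.subalgebra scale bracket \<hh>"
    and "\<kk> \<subset> \<hh>" and "\<hh> \<subset> \<gg>"
    and "lie_algebra.ideal_of scale bracket \<kk> \<hh>"
    and "lie_algebra.ideal_of scale bracket \<hh> \<gg>"
    and "\<not> lie_algebra.ideal_of scale bracket \<kk> \<gg>"
    and "lie_algebra.effective scale bracket \<gg> \<kk>"
  shows "lie_algebra.pair_order bracket \<gg> \<kk> \<ge> lie_algebra.sol_length scale bracket \<kk>"
proof -
  interpret finite_dimensional_lie_algebra scale bracket
    by (rule assms(1))
  show ?thesis
    by (rule sol_length_le_pair_order[OF assms(9) assms(8) assms(11)])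
qed

end
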